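(* Let $(\lambda_1,\lambda_2)\in[0.9,1]^2$, let $\gamma=\frac{-\lambda_1+\sqrt{\lambda_1^2+4\lambda_1\lambda_2}}{2\lambda_1\lambda_2}$, and let $(b_j)_{j\ge1}$, $b_j\in\{-1,1\}$, be a bitstream produced by the leaky golden ratio encoder with input $0$ and admissible quantizer parameters (as described in the context). For $n\ge 0$ let $$P_n(t)=b_1+\sum_{j=1}^{n}b_{j+1}t^j .$$ Suppose that for some $\epsilon>0$ one has $\gamma\le\gamma_{high}:=0.6491-\epsilon$. Let $\delta>0$ be such that $\delta$-transversality holds on the interval $[0,\gamma_{high}]$. Let $N$ be the smallest integer such that $\gamma^{N+1}\le(1-\gamma)\,\epsilon\,\delta$. Then for every integer $n\ge N$: (a) $P_n$ has a unique root $\gamma_n$ in $[0,0.6491]$; (b) $|\gamma-\gamma_n|\le C_1\gamma^n$, where $C_1=\frac{\gamma}{\delta(1-\gamma)}$.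
   Context: $\delta$-transversality: for $\rho\in(0,1)$ and $\delta>0$, $\delta$-transversality holds on $[0,\rho]$ if for every power series $g(x)=1+\sum_{j=1}^\infty a_jx^j$ with all $a_j\in\{-1,0,1\}$ and every $x\in[0,\rho]$, $g(x)<\delta$ implies $g'(x)<-\delta$. Leaky golden ratio encoder with input $0$: sequences $(u_n)_{n\ge0}$ of reals and $(b_n)_{n\ge1}$ in $\{-1,1\}$ satisfying $$u_0=u_1=0,\quad b_1=Q(0,0),\qquad u_{n+1}=\lambda_1u_n+\lambda_1\lambda_2u_{n-1}-b_n,\quad b_{n+1}=Q(u_n,u_{n+1})\quad(n\ge1),$$ where $Q=Q_\alpha^\nu$ is a flaky quantizer: $Q_\alpha^\nu(u,v)$ equals $-1$ if $u+\alpha v<-\nu$, equals $1$ if $u+\alpha v\ge\nu$, and is an arbitrary element of $\{-1,1\}$ (possibly different at each use) if $-\nu\le u+\alpha v<\nu$. Admissible quantizer parameters: for some tolerance $\tau\in[0,0.5]$, one has $0\le\nu\le\tau$ (with $\nu$ possibly varying at each occurrence) and $\alpha\in[1.198+1.198\,\tau,\ 2.281-0.952\,\tau]$. (The role of this range in the paper is that it guarantees that $(u_n)$ is bounded, whence $\sum_{j=1}^\infty b_j\gamma^j=0$.) *)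

theory Defs
  imports "HOL-Analysis.Analysis"
begin

text \<open>Transversality is meant for \<open>0 < \<rho> < 1\<close> and \<open>\<delta> > 0\<close>; in that range every such series converges
  in a neighbourhood of each point of \<open>[0, \<rho>]\<close>, so \<open>deriv\<close> is the genuine derivative there.
  The coefficient \<open>a 0\<close> is not used.\<close>

definition pm_series :: "(nat \<Rightarrow> real) \<Rightarrow> real \<Rightarrow> real" where
  "pm_series a x = 1 + (\<Sum>j. a (Suc j) * x ^ Suc j)"

definition transversal_on :: "real \<Rightarrow> real \<Rightarrow> bool" where
  "transversal_on \<delta> \<rho> \<longleftrightarrow>
     (\<forall>a. (\<forall>j\<ge>1. a j \<in> {-1, 0, 1}) \<longrightarrow>
        (\<forall>x\<in>{0..\<rho>}. pm_series a x < \<delta> \<longrightarrow> deriv (pm_series a) x < - \<delta>))"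

text \<open>A flaky quantizer may answer differently at each use, so it is modelled by the set of its
  possible outputs.\<close>

definition flaky_quantizer :: "real \<Rightarrow> real \<Rightarrow> real \<Rightarrow> real \<Rightarrow> real set" where
  "flaky_quantizer \<alpha> \<nu> u v =
     (if u + \<alpha> * v < - \<nu> then {-1}
      else if u + \<alpha> * v \<ge> \<nu> then {1}
      else {-1, 1})"

text \<open>The bits are indexed from 1, and \<open>\<nu> n\<close> is the flakiness in the use of the quantizer that
  produces \<open>b n\<close>. The values \<open>b 0\<close> and \<open>\<nu> 0\<close> are not used.\<close>

definition leaky_golden_ratio_encoder ::
    "real \<Rightarrow> real \<Rightarrow> real \<Rightarrow> (nat \<Rightarrow> real) \<Rightarrow> (nat \<Rightarrow> real) \<Rightarrow> (nat \<Rightarrow> real) \<Rightarrow> bool" where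
  "leaky_golden_ratio_encoder lam1 lam2 \<alpha> \<nu> u b \<longleftrightarrow>
     u 0 = 0 \<and> u 1 = 0 \<and> b 1 \<in> flaky_quantizer \<alpha> (\<nu> 1) 0 0 \<and>
     (\<forall>n\<ge>1. u (n + 1) = lam1 * u n + lam1 * lam2 * u (n - 1) - b n \<and>
             b (n + 1) \<in> flaky_quantizer \<alpha> (\<nu> (n + 1)) (u n) (u (n + 1)))"

definition admissible_parameters :: "real \<Rightarrow> (nat \<Rightarrow> real) \<Rightarrow> bool" where
  "admissible_parameters \<alpha> \<nu> \<longleftrightarrow>
     (\<exists>\<tau>\<in>{0..0.5}. (\<forall>n\<ge>1. 0 \<le> \<nu> n \<and> \<nu> n \<le> \<tau>) \<and>
        \<alpha> \<in> {1.198 + 1.198 * \<tau> .. 2.281 - 0.952 * \<tau>})"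

definition encoder_bitstream :: "real \<Rightarrow> real \<Rightarrow> (nat \<Rightarrow> real) \<Rightarrow> bool" where
  "encoder_bitstream lam1 lam2 b \<longleftrightarrow>
     (\<exists>\<alpha> \<nu> u. admissible_parameters \<alpha> \<nu> \<and> leaky_golden_ratio_encoder lam1 lam2 \<alpha> \<nu> u b)"

definition bit_poly :: "(nat \<Rightarrow> real) \<Rightarrow> nat \<Rightarrow> real \<Rightarrow> real" where
  "bit_poly b n t = b 1 + (\<Sum>j=1..n. b (j + 1) * t ^ j)"

end

theory Submission imports Defs begin

text \<open>With \<open>p = lam1 * lam2 * \<gamma>\<close> and \<open>\<phi> = 1 / \<gamma>\<close> the encoder recursion is diagonalised by
  \<open>w = u n + p * u (n - 1)\<close> and \<open>z = u n - \<phi> * u (n - 1)\<close>, which evolve by \<open>w \<mapsto> \<phi> w - b\<close> and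
  \<open>z \<mapsto> - p z - b\<close>. For admissible parameters the box \<open>\<bar>w\<bar> \<le> 1 / (\<phi> - 1)\<close>, \<open>\<bar>z\<bar> \<le> 1 / (1 - p)\<close> is
  invariant, and since the value at \<open>\<gamma>\<close> of the \<open>n\<close>-th bit polynomial is \<open>- \<gamma> ^ n\<close> times the
  coordinate \<open>w\<close> of step \<open>n + 2\<close>, it is at most \<open>\<gamma> ^ (n + 1) / (1 - \<gamma>) \<le> \<epsilon> \<delta>\<close> in absolute value.

  The assumed transversality controls roots to the left of \<open>\<gamma>\<close>, but a root may lie beyond \<open>\<gamma>_high\<close>.
  There, on \<open>[0.618, 0.6491]\<close>, a series with leading signs \<open>\<plusminus>1\<close> and small nonnegative value is shown
  to have slope below \<open>- 0.17\<close>, while an explicit polynomial shows that no \<open>\<delta>\<close> above \<open>0.17\<close> is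
  possible once \<open>\<gamma>_high \<ge> 0.618\<close>. So the slope is below \<open>- \<delta>\<close> wherever the signed bit polynomial has
  a value in \<open>[0, \<epsilon> \<delta>]\<close>, which gives existence, uniqueness and the distance estimate.\<close>

section \<open>Functions with negative slope at a level\<close>

text \<open>At the last point of \<open>[a, y]\<close> where \<open>f\<close> is at most
  \<open>c\<close>, its value is \<open>c\<close>, so the negative slope keeps \<open>f\<close>
  below \<open>c\<close> a little further to the right, a contradiction.\<close>

lemma le_barrier_if_deriv_neg:
  fixes f f' :: "real \<Rightarrow> real"
  assumes der: "\<And>x. x \<in> {a..b} \<Longrightarrow> (f has_real_derivative f' x) (at x)"
    and neg: "\<And>x. x \<in> {a..b} \<Longrightarrow> f x = c \<Longrightarrow> f' x < 0"
    and "f a \<le> c" and y: "y \<in> {a..b}"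
  shows "f y \<le> c"
proof (rule ccontr)
  assume "\<not> f y \<le> c"
  then have fy: "f y > c" by simp
  have cont: "continuous_on {a..y} f"
    using y by (intro continuous_at_imp_continuous_on ballI DERIV_isCont[OF der]) auto
  define S where "S = {x \<in> {a..y}. f x \<le> c}"
  have "closed S"
    unfolding S_def using continuous_on_closed_Collect_le[OF cont continuous_on_const[of _ c]] by simp
  moreover have "a \<in> S" "bdd_above S"
    using assms by (auto simp: S_def intro: bdd_aboveI[of _ y])
  ultimately have "Sup S \<in> S"
    using closed_contains_Sup by blast
  define t where "t = Sup S"
  have t: "t \<in> {a..y}" "f t \<le> c"
    using \<open>Sup S \<in> S\<close> by (auto simp: t_def S_def)
  have above: "f x > c" if "t < x" "x \<le> y" for x
  proof (rule ccontr)
    assume "\<not> f x > c"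
    then have "x \<in> S" using that t by (auto simp: S_def)
    then have "x \<le> t" using \<open>bdd_above S\<close> by (simp add: t_def cSup_upper)
    then show False using that by simp
  qed
  have "t < y" using t fy by (cases "t = y") auto
  have "\<exists>z\<ge>t. z \<le> y \<and> f z = c"
    using t fy by (intro IVT' continuous_on_subset[OF cont]) auto
  then have "f t = c"
    using above by (metis less_irrefl order.not_eq_order_implies_strict)
  have "t \<in> {a..b}" using t y by auto
  obtain d where "d > 0" and d: "\<And>h. 0 < h \<Longrightarrow> h < d \<Longrightarrow> f (t + h) < f t"
    using DERIV_neg_dec_right[OF der neg] \<open>t \<in> {a..b}\<close> \<open>f t = c\<close> by blast
  define h where "h = min (d / 2) (y - t)"
  have "0 < h" "h < d" "t + h \<le> y" using \<open>d > 0\<close> \<open>t < y\<close> by (auto simp: h_def)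
  then show False using d[of h] above[of "t + h"] \<open>f t = c\<close> by force
qed

text \<open>Just left of the larger root the negative slope makes \<open>f\<close> positive, but the
  barrier at level 0 starting from the smaller root forbids this.\<close>

lemma unique_root_if_deriv_neg:
  fixes f f' :: "real \<Rightarrow> real"
  assumes der: "\<And>x. x \<in> {a..b} \<Longrightarrow> (f has_real_derivative f' x) (at x)"
    and neg: "\<And>x. x \<in> {a..b} \<Longrightarrow> f x = 0 \<Longrightarrow> f' x < 0"
    and "r \<in> {a..b}" "s \<in> {a..b}" "f r = 0" "f s = 0"
  shows "r = s"
proof -
  have no: False if "r \<in> {a..b}" "s \<in> {a..b}" "f r = 0" "f s = 0" "r < s" for r s
  proof -
    have below: "f x \<le> 0" if "x \<in> {r..s}" for x
      by (rule le_barrier_if_deriv_neg[of r s f f']) (use der neg that \<open>r \<in> _\<close> \<open>s \<in> _\<close> \<open>f r = 0\<close> in auto)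
    obtain d where "d > 0" and d: "\<And>h. 0 < h \<Longrightarrow> h < d \<Longrightarrow> f s < f (s - h)"
      using DERIV_neg_dec_left[OF der neg] \<open>s \<in> {a..b}\<close> \<open>f s = 0\<close> by blast
    define h where "h = min (d / 2) (s - r)"
    have "0 < h" "h < d" "r \<le> s - h" using \<open>d > 0\<close> \<open>r < s\<close> by (auto simp: h_def)
    then show False using d[of h] below[of "s - h"] \<open>f s = 0\<close> by force
  qed
  show ?thesis using no[of r s] no[of s r] assms by (meson linorder_neqE)
qed

lemma steep_decrease:
  fixes f f' :: "real \<Rightarrow> real"
  assumes "a \<le> b" and der: "\<And>x. x \<in> {a..b} \<Longrightarrow> (f has_real_derivative f' x) (at x)"
    and "\<And>x. x \<in> {a..b} \<Longrightarrow> f' x < - d"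
  shows "f b \<le> f a - d * (b - a)"
proof (cases "a = b")
  case False
  then obtain z where "z > a" "z < b" and z: "f b - f a = (b - a) * f' z"
    using MVT2[of a b f f'] assms by fastforce
  then have "z \<in> {a..b}" by simp
  with z show ?thesis
    using assms mult_left_mono[of "f' z" "- d" "b - a"] by (auto simp: algebra_simps less_imp_le)
qed simp

section \<open>Finite power series and their slopes\<close>

lemma pm_series_finite:
  assumes "\<And>j. j > n \<Longrightarrow> a j = 0"
  shows "pm_series a x = 1 + (\<Sum>j=1..n. a j * x ^ j)"
proof -
  have "(\<Sum>j. a (Suc j) * x ^ Suc j) = (\<Sum>j<n. a (Suc j) * x ^ Suc j)"
    by (rule suminf_finite) (use assms in auto)
  also have "\<dots> = (\<Sum>j=1..n. a j * x ^ j)"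
    by (rule sum.reindex_bij_witness[of _ "\<lambda>j. j - 1" Suc]) auto
  finally show ?thesis by (simp add: pm_series_def)
qed

lemma pm_series_finite_derivative:
  assumes "\<And>j. j > n \<Longrightarrow> a j = 0"
  shows "(pm_series a has_real_derivative (\<Sum>j=1..n. a j * real j * x ^ (j - 1))) (at x)"
proof -
  have "((\<lambda>x. 1 + (\<Sum>j=1..n. a j * x ^ j)) has_real_derivative (\<Sum>j=1..n. a j * real j * x ^ (j - 1))) (at x)"
    by (auto intro!: derivative_eq_intros sum.cong)
  then show ?thesis using pm_series_finite[of n a, OF assms] by (metis (no_types, lifting) ext)
qed

text \<open>After the shift \<open>j = i + K + 1\<close> this is a partial sum of the differentiated
  geometric series.\<close>

lemma arithmetic_geometric_tail:
  fixes x :: real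
  assumes "0 \<le> x" "x < 1"
  shows "(\<Sum>j=Suc K..n. (real j - real K) * x ^ j) \<le> x ^ Suc K / (1 - x)\<^sup>2"
proof -
  have s: "(\<lambda>i. real (Suc i) * x ^ i) sums (1 / (1 - x)\<^sup>2)"
    using geometric_deriv_sums[of x] assms by simp
  have "(\<Sum>j=Suc K..n. (real j - real K) * x ^ j) = (\<Sum>i<n - K. x ^ Suc K * (real (Suc i) * x ^ i))"
    by (rule sum.reindex_bij_witness[of _ "\<lambda>i. i + Suc K" "\<lambda>j. j - Suc K"])
      (auto simp: power_add[symmetric] of_nat_diff simp flip: power_Suc)
  also have "\<dots> = x ^ Suc K * (\<Sum>i<n - K. real (Suc i) * x ^ i)"
    by (simp only: sum_distrib_left)
  also have "\<dots> \<le> x ^ Suc K * (1 / (1 - x)\<^sup>2)"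
    using sum_le_suminf[OF sums_summable[OF s], of "{..<n - K}"] sums_unique[OF s] assms
    by (intro mult_left_mono) auto
  finally show ?thesis by simp
qed

text \<open>In \<open>K g(x) - x g'(x)\<close> the coefficient \<open>a j\<close> has weight \<open>(K - j) x ^ j\<close>, which changes sign only at
  \<open>j = K\<close>: this converts \<open>g(x)\<close> being small into a slope bound.\<close>

lemma pm_series_weighted_lower_bound:
  assumes fin: "\<And>j. j > n \<Longrightarrow> a j = 0" and le1: "\<And>j. j \<ge> 1 \<Longrightarrow> \<bar>a j\<bar> \<le> 1"
    and x: "0 < x" "x < 1" and "K \<le> n"
  shows "real K * pm_series a x - x * deriv (pm_series a) x
    \<ge> real K + (\<Sum>j=1..K. a j * (real K - real j) * x ^ j) - x ^ Suc K / (1 - x)\<^sup>2"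
proof -
  have d: "deriv (pm_series a) x = (\<Sum>j=1..n. a j * real j * x ^ (j - 1))"
    by (rule DERIV_imp_deriv[OF pm_series_finite_derivative[OF fin]])
  have "x * deriv (pm_series a) x = (\<Sum>j=1..n. a j * real j * x ^ j)"
    unfolding d sum_distrib_left by (intro sum.cong refl) (auto simp: power_eq_if)
  then have "real K * pm_series a x - x * deriv (pm_series a) x
      = real K + (\<Sum>j=1..n. a j * (real K - real j) * x ^ j)"
    using pm_series_finite[of n a x] fin
    by (simp add: algebra_simps sum_distrib_left sum_subtractf)
  also have "(\<Sum>j=1..n. a j * (real K - real j) * x ^ j)
      = (\<Sum>j=1..K. a j * (real K - real j) * x ^ j) + (\<Sum>j=Suc K..n. a j * (real K - real j) * x ^ j)"
    using sum.ub_add_nat[of 1 K "\<lambda>j. a j * (real K - real j) * x ^ j" "n - K"] \<open>K \<le> n\<close> by simp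
  also have "(\<Sum>j=Suc K..n. a j * (real K - real j) * x ^ j) \<ge> (\<Sum>j=Suc K..n. - ((real j - real K) * x ^ j))"
  proof (rule sum_mono)
    fix j assume j: "j \<in> {Suc K..n}"
    have "a j * ((real j - real K) * x ^ j) \<le> 1 * ((real j - real K) * x ^ j)"
      by (rule mult_right_mono) (use le1[of j] j x in auto)
    then show "- ((real j - real K) * x ^ j) \<le> a j * (real K - real j) * x ^ j"
      by (simp add: algebra_simps)
  qed
  ultimately show ?thesis
    using arithmetic_geometric_tail[of x K n] x by (simp add: sum_negf)
qed

section \<open>Invariant box of the encoder\<close>

text \<open>The worst contribution of \<open>z\<close> and of the flakiness to the quantizer's argument is outweighed by
  that of any \<open>w\<close> for which a wrong bit would be harmful.\<close>

lemma quantizer_margin: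
  fixes \<phi> p \<alpha> \<tau> :: real
  assumes \<phi>: "1.54 \<le> \<phi>" "\<phi> \<le> 1.6181" and p: "0.55 \<le> p" "p \<le> 0.6181"
    and \<tau>: "0 \<le> \<tau>" "\<tau> \<le> 0.5" and \<alpha>: "1.198 + 1.198 * \<tau> \<le> \<alpha>" "\<alpha> \<le> 2.281 - 0.952 * \<tau>"
  shows "\<bar>1 - \<alpha> * p\<bar> + \<tau> * ((\<phi> + p) * (1 - p)) \<le> (1 + \<alpha> * \<phi>) * ((2 - \<phi>) * (1 - p))"
proof -
  have a0: "\<alpha> \<ge> 1.198" using \<alpha> \<tau> by simp
  have "0.3819 * 0.3819 \<le> (2 - \<phi>) * (1 - p)" using \<phi> p by (intro mult_mono) auto
  moreover have "1 + \<alpha> * 1.54 \<le> 1 + \<alpha> * \<phi>" using \<phi> a0 by (simp add: mult_left_mono)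
  ultimately have r: "(1 + \<alpha> * 1.54) * (0.3819 * 0.3819) \<le> (1 + \<alpha> * \<phi>) * ((2 - \<phi>) * (1 - p))"
    using a0 \<phi> p by (intro mult_mono) auto
  \<comment> \<open>If \<open>1 - \<alpha> * p\<close> is nonnegative, both terms on the left
    decrease in \<open>p\<close>, so \<open>p = 0.55\<close> is worst; the rest is linear in
    \<alpha> and \<tau> and is settled by the lower limit on \<alpha>.\<close>
  have "(\<phi> + p) * (1 - p) \<le> (1.6181 + 0.55) * 0.45"
  proof -
    have "(\<phi> + p) * (1 - p) \<le> (1.6181 + p) * (1 - p)" using \<phi> p by (intro mult_right_mono) auto
    also have "\<dots> = (1.6181 + 0.55) * 0.45 - (p - 0.55) * (p + 1.1681)" by (simp add: field_simps)
    also have "\<dots> \<le> (1.6181 + 0.55) * 0.45" using p by simp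
    finally show ?thesis .
  qed
  then have "1 - \<alpha> * p + \<tau> * ((\<phi> + p) * (1 - p)) \<le> 1 - \<alpha> * 0.55 + \<tau> * ((1.6181 + 0.55) * 0.45)"
    using \<tau> a0 p by (intro add_mono diff_mono mult_left_mono) auto
  also have "\<dots> \<le> (1 + \<alpha> * 1.54) * (0.3819 * 0.3819)"
    using \<tau> \<alpha> by (simp add: field_simps)
  also note r
  finally have A: "1 - \<alpha> * p + \<tau> * ((\<phi> + p) * (1 - p)) \<le> (1 + \<alpha> * \<phi>) * ((2 - \<phi>) * (1 - p))" .
  \<comment> \<open>For the other sign \<open>p = 0.6181\<close> is worst, as \<alpha> exceeds 1 and
    \<open>\<tau> * (p + 1.2362)\<close> does not; the upper limit on \<alpha> settles the
    rest.\<close>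
  have "\<alpha> * p - 1 + \<tau> * ((\<phi> + p) * (1 - p)) \<le> \<alpha> * p - 1 + \<tau> * ((1.6181 + p) * (1 - p))"
    using \<phi> p \<tau> by (intro add_left_mono mult_left_mono mult_right_mono) auto
  also have "\<dots> = \<alpha> * 0.6181 - 1 + \<tau> * (2.2362 * 0.3819) - (0.6181 - p) * (\<alpha> - \<tau> * (p + 1.2362))"
    by (simp add: field_simps)
  also have "\<dots> \<le> \<alpha> * 0.6181 - 1 + \<tau> * (2.2362 * 0.3819)"
  proof -
    have "\<tau> * (p + 1.2362) \<le> 0.5 * 2" using \<tau> p by (intro mult_mono) auto
    then show ?thesis using p a0 by simp
  qed
  also have "\<dots> \<le> (1 + \<alpha> * 1.54) * (0.3819 * 0.3819)"
    using \<tau> \<alpha> by (simp add: field_simps)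
  also note r
  finally show ?thesis using A by linarith
qed

text \<open>The upper end is safe because \<open>1 / (\<phi> - 1)\<close> is the fixed point of
  \<open>w \<mapsto> \<phi> w - 1\<close>; the last hypothesis says exactly that
  \<open>\<phi> * (bit * w) - 1\<close> stays above \<open>- 1 / (\<phi> - 1)\<close>.\<close>

lemma expanding_coordinate_step:
  fixes \<phi> w bit :: real
  assumes "1 < \<phi>" "bit \<in> {-1, 1}" "\<bar>w\<bar> * (\<phi> - 1) \<le> 1" "- (2 - \<phi>) \<le> bit * w * (\<phi> * (\<phi> - 1))"
  shows "\<bar>\<phi> * w - bit\<bar> * (\<phi> - 1) \<le> 1"
proof -
  have upper: "bit * w * (\<phi> - 1) * \<phi> \<le> 1 * \<phi>"
  proof (rule mult_right_mono)
    have "bit * w * (\<phi> - 1) \<le> \<bar>w\<bar> * (\<phi> - 1)"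
      using assms(1,2) by (intro mult_right_mono) auto
    then show "bit * w * (\<phi> - 1) \<le> 1" using assms(3) by simp
  qed (use assms(1) in simp)
  have "\<bar>\<phi> * w - bit\<bar> * (\<phi> - 1) = \<bar>(\<phi> * (bit * w) - 1) * (\<phi> - 1)\<bar>"
    using assms(1,2) by (auto simp: abs_mult)
  also have "\<dots> = \<bar>bit * w * (\<phi> * (\<phi> - 1)) - (\<phi> - 1)\<bar>" by (simp add: algebra_simps)
  also have "\<dots> \<le> 1"
  proof -
    have "bit * w * (\<phi> * (\<phi> - 1)) \<le> \<phi>" using upper by (simp add: mult_ac)
    then show ?thesis using assms(4) by linarith
  qed
  finally show ?thesis .
qed

text \<open>A flaky bit can disagree in sign with \<open>w\<close> only while \<open>w\<close> is
  small, which keeps the expanding coordinate in its interval; \<open>z\<close> contracts, so either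
  bit is harmless for it.\<close>

lemma encoder_step:
  fixes \<phi> p \<alpha> \<tau> \<nu> w z bit :: real
  assumes \<phi>: "1.54 \<le> \<phi>" "\<phi> \<le> 1.6181" "\<phi> * (\<phi> - 1) \<le> 1" and p: "0.55 \<le> p" "p \<le> 0.6181"
    and \<tau>: "0 \<le> \<tau>" "\<tau> \<le> 0.5" and \<alpha>: "1.198 + 1.198 * \<tau> \<le> \<alpha>" "\<alpha> \<le> 2.281 - 0.952 * \<tau>"
    and \<nu>: "0 \<le> \<nu>" "\<nu> \<le> \<tau>"
    and uv: "w = v + p * u" "z = v - \<phi> * u" and Q: "bit \<in> flaky_quantizer \<alpha> \<nu> u v"
    and w: "\<bar>w\<bar> * (\<phi> - 1) \<le> 1" and z: "\<bar>z\<bar> * (1 - p) \<le> 1"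
  shows "\<bar>\<phi> * w - bit\<bar> * (\<phi> - 1) \<le> 1" and "\<bar>- p * z - bit\<bar> * (1 - p) \<le> 1"
proof -
  have bit: "bit \<in> {-1, 1}" using Q by (auto simp: flaky_quantizer_def split: if_splits)
  have "- \<nu> \<le> bit * (u + \<alpha> * v)" using Q \<nu> by (auto simp: flaky_quantizer_def split: if_splits)
  \<comment> \<open>Eliminating \<open>u\<close> and \<open>v\<close> gives \<open>(\<phi> + p) * (u
    + \<alpha> * v) = (1 + \<alpha> * \<phi>) * w - (1 - \<alpha> * p) * z\<close>; the factor
    \<open>1 - p\<close> prepares the use of the bound on \<open>z\<close>.\<close>
  then have "- \<nu> * ((\<phi> + p) * (1 - p)) \<le> bit * (u + \<alpha> * v) * ((\<phi> + p) * (1 - p))"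
    using \<phi> p by (intro mult_right_mono) auto
  also have "\<dots> = bit * w * ((1 + \<alpha> * \<phi>) * (1 - p)) - bit * ((1 - \<alpha> * p) * z * (1 - p))"
    by (simp add: uv algebra_simps)
  finally have "- \<nu> * ((\<phi> + p) * (1 - p))
    \<le> bit * w * ((1 + \<alpha> * \<phi>) * (1 - p)) - bit * ((1 - \<alpha> * p) * z * (1 - p))" .
  moreover have "- (bit * ((1 - \<alpha> * p) * z * (1 - p))) \<le> \<bar>1 - \<alpha> * p\<bar> * (\<bar>z\<bar> * (1 - p))"
  proof -
    have "\<bar>bit * ((1 - \<alpha> * p) * z * (1 - p))\<bar> = \<bar>1 - \<alpha> * p\<bar> * (\<bar>z\<bar> * (1 - p))"
      using bit p by (auto simp: abs_mult)
    then show ?thesis by linarith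
  qed
  moreover have "\<bar>1 - \<alpha> * p\<bar> * (\<bar>z\<bar> * (1 - p)) \<le> \<bar>1 - \<alpha> * p\<bar> * 1" using z by (intro mult_left_mono) auto
  ultimately have "- (\<nu> * ((\<phi> + p) * (1 - p))) - \<bar>1 - \<alpha> * p\<bar> \<le> bit * w * ((1 + \<alpha> * \<phi>) * (1 - p))"
    by simp
  moreover have "\<nu> * ((\<phi> + p) * (1 - p)) \<le> \<tau> * ((\<phi> + p) * (1 - p))"
    using \<phi> p \<nu> by (intro mult_right_mono) auto
  ultimately have "- (2 - \<phi>) * ((1 + \<alpha> * \<phi>) * (1 - p)) \<le> bit * w * ((1 + \<alpha> * \<phi>) * (1 - p))"
    using quantizer_margin[OF \<phi>(1,2) p \<tau> \<alpha>] by (simp add: algebra_simps)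
  moreover have pos: "0 < (1 + \<alpha> * \<phi>) * (1 - p)"
    using \<phi> p \<alpha> \<tau> by (intro mult_pos_pos add_pos_nonneg mult_nonneg_nonneg) simp_all
  ultimately have lower: "- (2 - \<phi>) \<le> bit * w" by (simp only: mult_le_cancel_right_pos)
  have "- (2 - \<phi>) \<le> - (2 - \<phi>) * (\<phi> * (\<phi> - 1))"
    using mult_left_mono[OF \<phi>(3), of "2 - \<phi>"] \<phi> by simp
  also have "\<dots> \<le> bit * w * (\<phi> * (\<phi> - 1))"
    using lower \<phi> by (intro mult_right_mono) auto
  finally show "\<bar>\<phi> * w - bit\<bar> * (\<phi> - 1) \<le> 1"
    using expanding_coordinate_step[of \<phi> bit w] \<phi> bit w by simp
  have "\<bar>- p * z - bit\<bar> * (1 - p) \<le> (p * \<bar>z\<bar> + 1) * (1 - p)"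
    using bit p abs_triangle_ineq4[of "- p * z" bit] by (intro mult_right_mono) (auto simp: abs_mult)
  also have "\<dots> \<le> 1"
    using mult_left_mono[OF z, of p] p by (simp add: algebra_simps)
  finally show "\<bar>- p * z - bit\<bar> * (1 - p) \<le> 1" .
qed

section \<open>The leaky golden root and the bit polynomial there\<close>

lemma leaky_golden_root_bounds:
  fixes lam1 lam2 \<gamma> :: real
  assumes lam: "lam1 \<in> {0.9..1}" "lam2 \<in> {0.9..1}"
    and \<gamma>: "\<gamma> = (- lam1 + sqrt (lam1\<^sup>2 + 4 * lam1 * lam2)) / (2 * lam1 * lam2)"
  defines "p \<equiv> lam1 * lam2 * \<gamma>"
  shows "lam1 * \<gamma> + lam1 * lam2 * \<gamma>\<^sup>2 = 1" "0.618 \<le> \<gamma>" "1 \<le> \<gamma> + \<gamma>\<^sup>2" "0.55 \<le> p" "p \<le> 0.6181"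
proof -
  define r where "r = sqrt (lam1\<^sup>2 + 4 * lam1 * lam2)"
  have L: "0.81 \<le> lam1 * lam2" "lam1 * lam2 \<le> 1" 
    using mult_mono[of "0.9" lam1 "0.9" lam2] mult_mono[of lam1 1 lam2 1] lam by auto
  have r2: "r\<^sup>2 = lam1\<^sup>2 + 4 * lam1 * lam2" using L by (simp add: r_def)
  have "r > lam1" unfolding r_def using L lam by (intro real_less_rsqrt) auto
  have pr: "p = (r - lam1) / 2" using lam by (simp add: p_def \<gamma> r_def)
  then have "p > 0" using \<open>r > lam1\<close> by simp
  then have "\<gamma> > 0" using L unfolding p_def by (simp add: zero_less_mult_iff)
  have pp: "p\<^sup>2 + lam1 * p = lam1 * lam2"
    unfolding pr using r2 by (simp add: power2_eq_square field_simps)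
  show eq: "lam1 * \<gamma> + lam1 * lam2 * \<gamma>\<^sup>2 = 1"
  proof -
    have "lam1 * lam2 * (lam1 * \<gamma> + lam1 * lam2 * \<gamma>\<^sup>2) = lam1 * lam2 * 1"
      using pp by (simp add: p_def power2_eq_square algebra_simps)
    then show ?thesis using L by (subst (asm) mult_cancel_left) auto
  qed
  have "lam1 * \<gamma> \<le> 1 * \<gamma>" "lam1 * lam2 * \<gamma>\<^sup>2 \<le> 1 * \<gamma>\<^sup>2"
    using lam L \<open>\<gamma> > 0\<close> by (intro mult_right_mono; simp)+
  then show g: "1 \<le> \<gamma> + \<gamma>\<^sup>2" using eq by simp
  show "0.618 \<le> \<gamma>"
  proof (rule ccontr)
    assume "\<not> 0.618 \<le> \<gamma>"
    then have "\<gamma> * \<gamma> \<le> 0.618 * 0.618" using \<open>\<gamma> > 0\<close> by (intro mult_mono) auto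
    then show False using g \<open>\<not> _\<close> by (simp add: power2_eq_square)
  qed
  show "0.55 \<le> p"
  proof (rule ccontr)
    assume c: "\<not> 0.55 \<le> p"
    then have "p * p \<le> 0.55 * 0.55" using \<open>p > 0\<close> by (intro mult_mono) auto
    moreover have "0.9 * 0.35 \<le> lam1 * (lam2 - p)" using lam c by (intro mult_mono) auto
    ultimately show False using pp by (simp add: power2_eq_square algebra_simps)
  qed
  \<comment> \<open>With \<open>lam2 - p\<close> nonnegative, \<open>lam1\<close> and
    \<open>lam2\<close> may be raised to 1, which reduces to the golden case
    \<open>p\<^sup>2 + p \<le> 1\<close>.\<close>
  have "\<not> lam2 < p"
  proof
    assume "lam2 < p"
    then have "lam1 * lam2 \<le> lam1 * p" using lam by (intro mult_left_mono) auto
    moreover have "0 < p\<^sup>2" using \<open>p > 0\<close> by simp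
    ultimately show False using pp by linarith
  qed
  then have "lam1 * (lam2 - p) \<le> 1 * (1 - p)" using lam by (intro mult_mono) auto
  then have q: "p\<^sup>2 + p \<le> 1" using pp by (simp add: algebra_simps)
  show "p \<le> 0.6181"
  proof (rule ccontr)
    assume c: "\<not> p \<le> 0.6181"
    then have "0.6181 * 0.6181 \<le> p * p" by (intro mult_mono) auto
    then show False using q c by (simp add: power2_eq_square)
  qed
qed

lemma encoder_bitstream_values:
  assumes "encoder_bitstream lam1 lam2 b" "j \<ge> 1"
  shows "b j \<in> {-1, 1}"
proof -
  from assms(1) obtain \<alpha> \<nu> u where enc: "leaky_golden_ratio_encoder lam1 lam2 \<alpha> \<nu> u b"
    unfolding encoder_bitstream_def by blast
  have "\<exists>x y. b j \<in> flaky_quantizer \<alpha> (\<nu> j) x y"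
  proof (cases "j = 1")
    case False
    then have "j - 1 \<ge> 1" "j - 1 + 1 = j" using assms(2) by auto
    then show ?thesis using enc unfolding leaky_golden_ratio_encoder_def by metis
  qed (use enc in \<open>auto simp: leaky_golden_ratio_encoder_def\<close>)
  then show ?thesis by (auto simp: flaky_quantizer_def split: if_splits)
qed

lemma bit_poly_at_golden_root:
  fixes lam1 lam2 \<gamma> :: real
  assumes lam: "lam1 \<in> {0.9..1}" "lam2 \<in> {0.9..1}"
    and \<gamma>: "\<gamma> = (- lam1 + sqrt (lam1\<^sup>2 + 4 * lam1 * lam2)) / (2 * lam1 * lam2)"
    and "\<gamma> \<le> 0.6491" and enc: "encoder_bitstream lam1 lam2 b"
  shows "\<bar>bit_poly b n \<gamma>\<bar> \<le> \<gamma> ^ (n + 1) / (1 - \<gamma>)"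
proof -
  note g = leaky_golden_root_bounds[OF lam \<gamma>]
  define \<phi> where "\<phi> = 1 / \<gamma>"
  define p where "p = lam1 * lam2 * \<gamma>"
  have \<gamma>\<phi>: "\<gamma> * \<phi> = 1" using g(2) by (simp add: \<phi>_def)
  \<comment> \<open>With the next identity this makes \<phi> and \<open>- p\<close> the roots of
    \<open>x\<^sup>2 = lam1 * x + lam1 * lam2\<close>, the characteristic equation of the
    recursion.\<close>
  have \<phi>p: "\<phi> = lam1 + p"
    using g(1,2) by (simp add: \<phi>_def p_def power2_eq_square field_simps)
  have Lp: "\<phi> * p = lam1 * lam2" using \<gamma>\<phi> by (simp add: p_def algebra_simps)
  have \<phi>: "1.54 \<le> \<phi>" "\<phi> \<le> 1.6181" "\<phi> * (\<phi> - 1) \<le> 1"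
  proof -
    show "1.54 \<le> \<phi>" using g(2) assms(4) by (simp add: \<phi>_def field_simps)
    show "\<phi> \<le> 1.6181" using g(5) lam unfolding \<phi>p p_def by simp
    show "\<phi> * (\<phi> - 1) \<le> 1" using g(2,3) by (simp add: \<phi>_def field_simps power2_eq_square)
  qed
  obtain \<alpha> \<nu> u \<tau> where \<tau>': "\<tau> \<in> {0..0.5}" and \<nu>: "\<And>n. n \<ge> 1 \<Longrightarrow> 0 \<le> \<nu> n \<and> \<nu> n \<le> \<tau>"
    and \<alpha>': "\<alpha> \<in> {1.198 + 1.198 * \<tau> .. 2.281 - 0.952 * \<tau>}"
    and u: "leaky_golden_ratio_encoder lam1 lam2 \<alpha> \<nu> u b"
    using enc unfolding encoder_bitstream_def admissible_parameters_def by blast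
  have \<tau>: "0 \<le> \<tau>" "\<tau> \<le> 0.5" and \<alpha>: "1.198 + 1.198 * \<tau> \<le> \<alpha>" "\<alpha> \<le> 2.281 - 0.952 * \<tau>"
    using \<tau>' \<alpha>' by (simp_all only: atLeastAtMost_iff)
  have u0: "u 0 = 0" "u (Suc 0) = 0"
    and rec: "u (Suc (Suc m)) = lam1 * u (Suc m) + lam1 * lam2 * u m - b (Suc m)" for m
    using u by (auto simp: leaky_golden_ratio_encoder_def)
  have Q: "b (Suc m) \<in> flaky_quantizer \<alpha> (\<nu> (Suc m)) (u m) (u (Suc m))" for m
  proof (cases m)
    case (Suc k)
    then have "m \<ge> 1" by simp
    then show ?thesis using u unfolding leaky_golden_ratio_encoder_def Suc_eq_plus1 by blast
  qed (use u in \<open>simp add: leaky_golden_ratio_encoder_def\<close>)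
  have wz: "\<bar>u (Suc m) + p * u m\<bar> * (\<phi> - 1) \<le> 1 \<and> \<bar>u (Suc m) - \<phi> * u m\<bar> * (1 - p) \<le> 1" for m
  proof (induction m)
    case 0
    then show ?case by (simp add: u0)
  next
    case (Suc m)
    have "u (Suc (Suc m)) + p * u (Suc m) = \<phi> * (u (Suc m) + p * u m) - b (Suc m)"
      using \<phi>p Lp rec[of m] by (simp add: distrib_left mult.assoc[symmetric]) (simp add: algebra_simps)
    moreover have "u (Suc (Suc m)) - \<phi> * u (Suc m) = - p * (u (Suc m) - \<phi> * u m) - b (Suc m)"
      using \<phi>p Lp[symmetric] rec[of m] by (simp add: algebra_simps)
    ultimately show ?case
      using encoder_step[OF \<phi> g(4)[folded p_def] g(5)[folded p_def] \<tau> \<alpha> _ _ refl refl Q[of m]] \<nu>[of "Suc m"] Suc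
      by simp
  qed
  \<comment> \<open>Multiplied by \<open>\<gamma> ^ Suc m\<close>, the recursion
    \<open>w \<mapsto> \<phi> w - b\<close> telescopes because \<open>\<gamma> * \<phi> = 1\<close>;
    it starts from \<open>u 2 = - b 1\<close>.\<close>
  have "bit_poly b m \<gamma> = - (\<gamma> ^ m * (u (Suc (Suc m)) + p * u (Suc m)))" for m
  proof (induction m)
    case 0
    then show ?case using rec[of 0] by (simp add: bit_poly_def u0)
  next
    case (Suc m)
    have "u (Suc (Suc (Suc m))) + p * u (Suc (Suc m)) = \<phi> * (u (Suc (Suc m)) + p * u (Suc m)) - b (Suc (Suc m))"
      using \<phi>p Lp rec[of "Suc m"] by (simp add: distrib_left mult.assoc[symmetric]) (simp add: algebra_simps)
    moreover have "bit_poly b (Suc m) \<gamma> = bit_poly b m \<gamma> + b (Suc (Suc m)) * \<gamma> ^ Suc m"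
      by (simp add: bit_poly_def)
    moreover have "\<gamma> ^ m = \<gamma> ^ Suc m * \<phi>" using \<gamma>\<phi> by (simp add: mult_ac)
    ultimately show ?case using Suc by (simp only:) (simp only: algebra_simps)
  qed
  then have "\<bar>bit_poly b n \<gamma>\<bar> = \<gamma> ^ n * \<bar>u (Suc (Suc n)) + p * u (Suc n)\<bar>"
    using g(2) by (simp add: abs_mult)
  also have "\<dots> \<le> \<gamma> ^ n * (1 / (\<phi> - 1))"
    using wz[of "Suc n"] \<phi> g(2) by (intro mult_left_mono) (auto simp: field_simps)
  also have "1 / (\<phi> - 1) = \<gamma> / (1 - \<gamma>)"
    using g(2) by (simp add: \<phi>_def field_simps)
  finally show ?thesis by (simp add: algebra_simps)
qed

section \<open>Transversality on \<open>[0.618, 0.6491]\<close>\<close>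

text \<open>The first bound excludes the start \<open>-1, -1, -1, -1\<close>; the others evaluate
  the weighted bound for \<open>K = 4\<close> at the start \<open>-1, -1, 1\<close> and for
  \<open>K = 5\<close> at \<open>-1, -1, -1, 1\<close>.\<close>

lemma estimates_near_golden_root:
  fixes x :: real
  assumes x: "0.618 \<le> x" "x \<le> 0.6491"
  shows "1 - 2 * x + 2 * x ^ 5 < 0"
    and "0.2 \<le> 4 - 3 * x - 2 * x\<^sup>2 + x ^ 3 - x ^ 5 / (1 - x)\<^sup>2"
    and "0.16 \<le> 5 - 4 * x - 3 * x\<^sup>2 - 2 * x ^ 3 + x ^ 4 - x ^ 6 / (1 - x)\<^sup>2"
proof -
  have le: "x ^ k \<le> 0.6491 ^ k" for k using x by (intro power_mono) auto
  have ge: "0.618 ^ k \<le> x ^ k" for k using x by (intro power_mono) auto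
  \<comment> \<open>Bounding only \<open>x ^ 4\<close> leaves \<open>1 - 1.64 * x\<close>, negative
    from \<open>0.618\<close> on.\<close>
  have "x ^ 4 \<le> 0.18" using le[of 4] by (simp add: power_divide)
  then have "x * x ^ 4 \<le> x * 0.18" using x by (intro mult_left_mono) auto
  moreover have "x ^ 5 = x * x ^ 4" by (simp add: eval_nat_numeral)
  ultimately have "x ^ 5 \<le> x * 0.18" by (simp only:)
  then show "1 - 2 * x + 2 * x ^ 5 < 0" using x by simp
  have q: "x ^ k / (1 - x)\<^sup>2 \<le> 0.6491 ^ k / 0.3509\<^sup>2" for k
    using x by (intro frac_le le power_mono) auto
  show "0.2 \<le> 4 - 3 * x - 2 * x\<^sup>2 + x ^ 3 - x ^ 5 / (1 - x)\<^sup>2"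
    using x q[of 5] le[of 2] ge[of 3] by (simp add: eval_nat_numeral)
  \<comment> \<open>Grouping \<open>2 * x ^ 3 - x ^ 4\<close> as a product of two increasing factors
    puts its maximum at \<open>0.6491\<close>.\<close>
  have "0.3509\<^sup>2 \<le> (1 - x)\<^sup>2" using x by (intro power_mono) auto
  then have "x\<^sup>2 * (1 - (1 - x)\<^sup>2) \<le> 0.6491\<^sup>2 * (1 - 0.3509\<^sup>2)"
    using x by (intro mult_mono le) (auto simp: power_le_one)
  moreover have "2 * x ^ 3 - x ^ 4 = x\<^sup>2 * (1 - (1 - x)\<^sup>2)"
    by (simp add: algebra_simps eval_nat_numeral)
  ultimately have "2 * x ^ 3 - x ^ 4 \<le> 0.6491\<^sup>2 * (1 - 0.3509\<^sup>2)" by simp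
  then show "0.16 \<le> 5 - 4 * x - 3 * x\<^sup>2 - 2 * x ^ 3 + x ^ 4 - x ^ 6 / (1 - x)\<^sup>2"
    using x q[of 6] le[of 2] by (simp add: eval_nat_numeral)
qed


lemma sum_up_to_4_and_5:
  fixes f :: "nat \<Rightarrow> real"
  shows "(\<Sum>j=1..4. f j) = f 1 + f 2 + f 3 + f 4" "(\<Sum>j=1..5. f j) = f 1 + f 2 + f 3 + f 4 + f 5"
  by (simp_all add: eval_nat_numeral)

text \<open>The weight \<open>K = 5\<close> suffices once \<open>a 1 = a 2 = a 3 = -1\<close>, because \<open>a 4 = -1\<close> would then make the
  series negative; any other start leaves enough room for \<open>K = 4\<close>.\<close>

lemma transversal_near_golden_root:
  assumes fin: "\<And>j. j > n \<Longrightarrow> a j = 0" and le1: "\<And>j. j \<ge> 1 \<Longrightarrow> \<bar>a j\<bar> \<le> 1"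
    and pm: "\<And>j. 1 \<le> j \<Longrightarrow> j \<le> 4 \<Longrightarrow> a j \<in> {-1, 1}" and "5 \<le> n"
    and x: "0.618 \<le> x" "x \<le> 0.6491" and pos: "0 \<le> pm_series a x"
  shows "x * deriv (pm_series a) x \<le> 5 * pm_series a x - 0.16"
proof (cases "a 1 = -1 \<and> a 2 = -1 \<and> a 3 = -1")
  case False
  have x01: "0 < x" "x < 1" using x by auto
  have decr: "0 \<le> x ^ 3" "x ^ 3 \<le> x\<^sup>2" "x ^ 3 \<le> x"
    using x power_decreasing[of 2 3 x] power_decreasing[of 1 3 x] by simp_all
  have w: "4 + (3 * a 1 * x + 2 * a 2 * x\<^sup>2 + a 3 * x ^ 3) - x ^ 5 / (1 - x)\<^sup>2
      \<le> 4 * pm_series a x - x * deriv (pm_series a) x"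
    using pm_series_weighted_lower_bound[of n a x 4, OF fin le1] x01 \<open>5 \<le> n\<close> unfolding sum_up_to_4_and_5
    by (simp add: algebra_simps)
  \<comment> \<open>A plus sign gains least at the highest power, so \<open>-1, -1, 1\<close> is the
    worst start containing one.\<close>
  have "- 3 * x - 2 * x\<^sup>2 + x ^ 3 \<le> 3 * a 1 * x + 2 * a 2 * x\<^sup>2 + a 3 * x ^ 3"
  proof -
    have bounds: "- x \<le> a 1 * x" "- x\<^sup>2 \<le> a 2 * x\<^sup>2" "- (x ^ 3) \<le> a 3 * x ^ 3"
      using pm[of 1] pm[of 2] pm[of 3] x01 by auto
    from False pm[of 1] pm[of 2] pm[of 3] consider "a 1 = 1" | "a 2 = 1" | "a 3 = 1" by auto
    then show ?thesis
    proof cases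
      case 1
      then have "a 1 * x = x" by simp
      then show ?thesis using bounds decr x01 by linarith
    next
      case 2
      then have "a 2 * x\<^sup>2 = x\<^sup>2" by simp
      then show ?thesis using bounds decr x01 by linarith
    next
      case 3
      then have "a 3 * x ^ 3 = x ^ 3" by simp
      then show ?thesis using bounds by linarith
    qed
  qed
  then have "0.2 \<le> 4 * pm_series a x - x * deriv (pm_series a) x"
    using w estimates_near_golden_root(2)[OF x] by linarith
  then show ?thesis using pos by simp
next
  case True
  have x01: "0 < x" "x < 1" using x by auto
  have "a 4 = 1"
  proof (rule ccontr)
    assume "a 4 \<noteq> 1"
    then have a4: "a 4 = -1" using pm[of 4] by simp
    have "pm_series a x = 1 + (\<Sum>j=1..4. a j * x ^ j) + (\<Sum>j=5..n. a j * x ^ j)"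
      using sum.ub_add_nat[of 1 4 "\<lambda>j. a j * x ^ j" "n - 4"] \<open>5 \<le> n\<close> pm_series_finite[of n a, OF fin] by simp
    also have "(\<Sum>j=1..4. a j * x ^ j) = - x - x\<^sup>2 - x ^ 3 - x ^ 4"
      using True a4 unfolding sum_up_to_4_and_5 by simp
    also have "(\<Sum>j=5..n. a j * x ^ j) \<le> (\<Sum>j=5..n. 1 * x ^ j)"
      by (intro sum_mono mult_right_mono abs_le_D1[OF le1]) (use x01 in auto)
    also have "\<dots> \<le> x ^ 5 / (1 - x)"
      using x01 \<open>5 \<le> n\<close> by (simp add: sum_gp field_simps)
    also have "1 + (- x - x\<^sup>2 - x ^ 3 - x ^ 4) + x ^ 5 / (1 - x) = (1 - 2 * x + 2 * x ^ 5) / (1 - x)"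
      using x01 by (simp add: field_simps eval_nat_numeral)
    also have "\<dots> < 0"
      using estimates_near_golden_root(1)[OF x] x01 by (intro divide_neg_pos) auto
    finally show False using pos by simp
  qed
  then show ?thesis
    using pm_series_weighted_lower_bound[of n a x 5, OF fin le1] x01 \<open>5 \<le> n\<close> True
      estimates_near_golden_root(3)[OF x] unfolding sum_up_to_4_and_5 by (simp add: algebra_simps)
qed

text \<open>The polynomial with signs minus for \<open>j = 1, 2, 3\<close> and plus for
  \<open>j = 4, ..., 11\<close> has at \<rho> a value of at most \<open>0.17\<close> and a slope of
  at least \<open>- 0.17\<close>, so it refutes any larger \<delta>.\<close>

lemma transversality_constant_bound:
  assumes "transversal_on \<delta> \<rho>" and \<rho>: "0.618 \<le> \<rho>" "\<rho> \<le> 0.6491"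
  shows "\<delta> \<le> 0.17"
proof -
  define a :: "nat \<Rightarrow> real" where "a j = (if j \<le> 3 then -1 else if j \<le> 11 then 1 else 0)" for j
  have fin: "a j = 0" if "j > 11" for j using that by (simp add: a_def)
  have le: "\<rho> ^ k \<le> 0.6491 ^ k" for k using \<rho> by (intro power_mono) auto
  have ge: "0.618 ^ k \<le> \<rho> ^ k" for k using \<rho> by (intro power_mono) auto
  define t where "t = \<rho> - 0.618"
  have t: "0 \<le> t" "t \<le> 0.0311" and \<rho>t: "\<rho> = t + 0.618" using \<rho> by (auto simp: t_def)
  have "pm_series a \<rho> = 1 - \<rho> - \<rho>\<^sup>2 - \<rho> ^ 3 + \<rho> ^ 4 * (1 + \<rho> + \<rho>\<^sup>2 + \<rho> ^ 3 + \<rho> ^ 4 + \<rho> ^ 5 + \<rho> ^ 6 + \<rho> ^ 7)"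
    unfolding pm_series_finite[of 11 a, OF fin, simplified] by (simp add: a_def eval_nat_numeral algebra_simps)
  \<comment> \<open>\<open>2.77\<close> bounds the bracket at the right end \<open>0.6491\<close>;
    below, \<open>13.9\<close> bounds the derivative's bracket at the left end
    \<open>0.618\<close>.\<close>
  also have "\<dots> \<le> 1 - \<rho> - \<rho>\<^sup>2 - \<rho> ^ 3 + \<rho> ^ 4 * 2.77"
    using \<rho> le[of 2] le[of 3] le[of 4] le[of 5] le[of 6] le[of 7]
    by (intro add_left_mono mult_left_mono) (simp_all add: eval_nat_numeral)
  also have "\<dots> \<le> 0.17"
  proof -
    have "t * t \<le> 0.0311 * t" using t by (intro mult_right_mono) auto
    moreover have "t * t * t \<le> 0.0311 * 0.0311 * t" using t by (intro mult_right_mono mult_mono) auto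
    moreover have "t * t * t * t \<le> 0.0311 * 0.0311 * 0.0311 * t" using t by (intro mult_right_mono mult_mono) auto
    ultimately show ?thesis using t unfolding \<rho>t by (simp add: field_simps eval_nat_numeral)
  qed
  finally have val: "pm_series a \<rho> \<le> 0.17" .
  have "deriv (pm_series a) \<rho> = - 1 - 2 * \<rho> - 3 * \<rho>\<^sup>2 + \<rho> ^ 3 * (4 + 5 * \<rho> + 6 * \<rho>\<^sup>2 + 7 * \<rho> ^ 3
      + 8 * \<rho> ^ 4 + 9 * \<rho> ^ 5 + 10 * \<rho> ^ 6 + 11 * \<rho> ^ 7)"
    unfolding DERIV_imp_deriv[OF pm_series_finite_derivative[of 11 a, OF fin, simplified]]
    by (simp add: a_def eval_nat_numeral algebra_simps)
  also have "\<dots> \<ge> - 1 - 2 * \<rho> - 3 * \<rho>\<^sup>2 + \<rho> ^ 3 * 13.9"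
    using \<rho> ge[of 2] ge[of 3] ge[of 4] ge[of 5] ge[of 6] ge[of 7]
    by (intro add_left_mono mult_left_mono) (simp_all add: eval_nat_numeral)
  \<comment> \<open>Expanded in \<open>t\<close>, the excess over \<open>- 0.17\<close> has only
    nonnegative coefficients.\<close>
  also have "- 1 - 2 * \<rho> - 3 * \<rho>\<^sup>2 + \<rho> ^ 3 * 13.9 \<ge> - 0.17"
    unfolding \<rho>t
  proof (simp add: field_simps eval_nat_numeral, rule order_trans[of _ 0])
  qed (use t in auto)
  finally have "\<not> deriv (pm_series a) \<rho> < - 0.17" by simp
  moreover have "pm_series a \<rho> < \<delta> \<longrightarrow> deriv (pm_series a) \<rho> < - \<delta>"
    using assms(1) \<rho> unfolding transversal_on_def by (auto simp: a_def)
  ultimately show ?thesis using val by linarith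
qed

section \<open>The root near \<gamma>\<close>

theorem theorem3p3:
  fixes lam1 lam2 \<gamma> \<epsilon> \<gamma>_high \<delta> C1 :: real and b :: "nat \<Rightarrow> real" and N :: int
  assumes "lam1 \<in> {0.9..1}" and "lam2 \<in> {0.9..1}"
    and "\<gamma> = (- lam1 + sqrt (lam1\<^sup>2 + 4 * lam1 * lam2)) / (2 * lam1 * lam2)"
    and "encoder_bitstream lam1 lam2 b"
    and "\<epsilon> > 0" and "\<gamma>_high = 0.6491 - \<epsilon>" and "\<gamma> \<le> \<gamma>_high"
    and "\<delta> > 0" and "transversal_on \<delta> \<gamma>_high"
    and "\<gamma> powi (N + 1) \<le> (1 - \<gamma>) * \<epsilon> * \<delta>"
    and "\<And>m :: int. \<gamma> powi (m + 1) \<le> (1 - \<gamma>) * \<epsilon> * \<delta> \<Longrightarrow> N \<le> m"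
    and "C1 = \<gamma> / (\<delta> * (1 - \<gamma>))"
  shows "\<forall>n::nat. int n \<ge> N \<longrightarrow>
           (\<exists>!x. x \<in> {0..0.6491} \<and> bit_poly b n x = 0) \<and>
           (\<forall>\<gamma>n. \<gamma>n \<in> {0..0.6491} \<and> bit_poly b n \<gamma>n = 0 \<longrightarrow> \<bar>\<gamma> - \<gamma>n\<bar> \<le> C1 * \<gamma> ^ n)"
proof (intro allI impI)
  fix n :: nat assume n: "int n \<ge> N"
  note lam = assms(1,2) and \<gamma> = assms(3)
  note g = leaky_golden_root_bounds[OF lam \<gamma>]
  have \<gamma>l: "0.618 \<le> \<gamma>" "\<gamma> \<le> 0.6491" and \<epsilon>: "0 < \<epsilon>" "\<epsilon> \<le> 0.0311" "\<gamma> + \<epsilon> \<le> 0.6491"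
    using g(2) assms(5-7) by auto
  have \<delta>: "0 < \<delta>" "\<delta> \<le> 0.17"
    using transversality_constant_bound[OF assms(9)] assms(5-8) \<gamma>l by auto
  \<comment> \<open>\<open>e\<close> bounds the value at \<gamma> and is the drop at slope
    \<open>- \<delta>\<close> over a length \<epsilon>. The constants are
    \<open>0.0311 = 0.6491 - 0.618\<close> and \<open>0.1555 = 5 * 0.0311\<close>.\<close>
  define e where "e = \<epsilon> * \<delta>"
  have e: "0 < e" "e < \<delta>" "5 * e \<le> 0.1555 * \<delta>" "e \<le> 0.0311 * 0.17"
    using \<epsilon> \<delta> mult_strict_right_mono[of \<epsilon> 1 \<delta>] mult_right_mono[of \<epsilon> "0.0311" \<delta>] mult_mono[of \<epsilon> "0.0311" \<delta> "0.17"]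
    by (auto simp: e_def)
  have "\<gamma> powi (int n + 1) \<le> \<gamma> powi (N + 1)"
    using n \<gamma>l by (intro power_int_decreasing) auto
  then have small: "\<gamma> ^ (n + 1) \<le> (1 - \<gamma>) * e"
    using assms(10) by (simp add: e_def power_int_def nat_add_distrib)
  \<comment> \<open>\<open>\<gamma> ^ (n + 1)\<close> is below \<open>0.0053\<close>, whereas
    \<open>0.618 ^ 5\<close> is about \<open>0.09\<close>.\<close>
  have "5 \<le> n"
  proof (rule ccontr)
    assume "\<not> 5 \<le> n"
    then have "\<gamma> ^ 5 \<le> \<gamma> ^ (n + 1)" using \<gamma>l by (intro power_decreasing) auto
    moreover have "0.618 ^ 5 \<le> \<gamma> ^ 5" using \<gamma>l by (intro power_mono) auto
    moreover have "(1 - \<gamma>) * e \<le> 1 * (0.0311 * 0.17)" using \<gamma>l e by (intro mult_mono) auto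
    ultimately have "(0.618::real) ^ 5 \<le> 1 * (0.0311 * 0.17)" using small by (meson order_trans)
    then show False by (simp add: power_divide)
  qed
  \<comment> \<open>The factor \<open>b 1\<close> normalises the constant term to 1; zeros beyond
    \<open>n\<close> turn the polynomial into an admissible series.\<close>
  define c where "c j = (if j \<le> n then b 1 * b (j + 1) else 0)" for j
  have bits: "b j \<in> {-1, 1}" if "j \<ge> 1" for j
    by (rule encoder_bitstream_values[OF assms(4) that])
  have fin: "c j = 0" if "j > n" for j using that by (simp add: c_def)
  have pm: "c j \<in> {-1, 1}" if "1 \<le> j" "j \<le> n" for j
    using bits[of 1] bits[of "j + 1"] that by (auto simp: c_def)
  have c01: "c j \<in> {-1, 0, 1}" if "1 \<le> j" for j using pm[of j] that fin[of j] by (cases "j \<le> n") auto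
  have le1: "\<bar>c j\<bar> \<le> 1" if "1 \<le> j" for j using c01[OF that] by auto
  define f where "f = pm_series c"
  define f' where "f' = deriv f"
  have f_eq: "f x = b 1 * bit_poly b n x" for x
  proof -
    have "b 1 * b 1 = 1" using bits[of 1] by auto
    then show ?thesis
      using pm_series_finite[of n c x] fin
      by (simp add: f_def bit_poly_def distrib_left sum_distrib_left c_def mult.assoc)
  qed
  have root_iff: "bit_poly b n x = 0 \<longleftrightarrow> f x = 0" for x using bits[of 1] by (auto simp: f_eq)
  have der: "(f has_real_derivative f' x) (at x)" for x
  proof -
    have d: "(f has_real_derivative (\<Sum>j=1..n. c j * real j * x ^ (j - 1))) (at x)"
      unfolding f_def by (rule pm_series_finite_derivative) (rule fin)
    then show ?thesis unfolding f'_def DERIV_imp_deriv[OF d] .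
  qed
  have cont: "continuous_on S f" for S
    by (intro continuous_at_imp_continuous_on ballI DERIV_isCont[OF der])
  have f0: "f 0 = 1" using pm_series_finite[of n c 0, OF fin] by (simp add: f_def)
  have f\<gamma>: "\<bar>f \<gamma>\<bar> \<le> \<gamma> ^ (n + 1) / (1 - \<gamma>)"
    using bit_poly_at_golden_root[OF lam \<gamma> \<gamma>l(2) assms(4), of n] bits[of 1] by (auto simp: f_eq abs_mult)
  also have "\<dots> \<le> e" using small \<gamma>l by (simp add: pos_divide_le_eq mult.commute)
  finally have f\<gamma>e: "f \<gamma> \<le> e" by simp
  have left: "f' x < - \<delta>" if "0 \<le> x" "x \<le> \<gamma>" "f x < \<delta>" for x
  proof -
    have "x \<in> {0..\<gamma>_high}" using that assms(7) by simp
    then show ?thesis using assms(9) that(3) c01 unfolding transversal_on_def f'_def f_def by blast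
  qed
  \<comment> \<open>Here \<open>\<delta> \<le> 0.17\<close> enters: it makes
    \<open>5 * e - 0.16\<close> smaller than \<open>- 0.6491 * \<delta>\<close>.\<close>
  have right: "f' x < - \<delta>" if "\<gamma> \<le> x" "x \<le> 0.6491" "0 \<le> f x" "f x \<le> e" for x
  proof -
    have "x * f' x \<le> 5 * f x - 0.16"
      unfolding f'_def f_def
      by (rule transversal_near_golden_root[of n]) (use that fin le1 pm \<open>5 \<le> n\<close> \<gamma>l in \<open>auto simp: f_def\<close>)
    also have "\<dots> < - (0.6491 * \<delta>)" using that(4) e \<delta> by simp
    also have "\<dots> \<le> x * - \<delta>" using that(2) \<delta> by simp
    finally have "x * f' x < x * - \<delta>" .
    moreover have "0 < x" using that \<gamma>l by simp
    ultimately show ?thesis by (simp only: mult_less_cancel_left_pos)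
  qed
  have at_root: "f' x < 0" if "x \<in> {0..0.6491}" "f x = 0" for x
  proof (cases "x \<le> \<gamma>")
    case True
    then show ?thesis using left[of x] that \<delta> by simp
  next
    case False
    then show ?thesis using right[of x] that e \<delta> by simp
  qed
  have unique: "x = y" if "x \<in> {0..0.6491}" "y \<in> {0..0.6491}" "f x = 0" "f y = 0" for x y
    by (rule unique_root_if_deriv_neg[of 0 "0.6491" f f']) (use der at_root that in auto)
  \<comment> \<open>The slope bound \<open>right\<close> presupposes \<open>f x \<le> e\<close>; the
    barrier at level \<open>e\<close> secures this all the way to \<open>0.6491\<close>.\<close>
  have below_e: "f x \<le> e" if "\<gamma> \<le> x" "x \<le> 0.6491" for x
  proof (rule le_barrier_if_deriv_neg[of \<gamma> "0.6491" f f'])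
    show "f' y < 0" if "y \<in> {\<gamma>..0.6491}" "f y = e" for y
      using right[of y] that e \<delta> by simp
  qed (use der f\<gamma>e that in auto)
  have ex: "\<exists>x\<in>{0..0.6491}. f x = 0"
  proof (cases "f \<gamma> \<le> 0")
    case True
    then obtain x where "0 \<le> x" "x \<le> \<gamma>" "f x = 0"
      using IVT2'[of f \<gamma> 0 0] f0 cont \<gamma>l by auto
    then show ?thesis using \<gamma>l by (intro bexI[of _ x]) auto
  next
    case False
    show ?thesis
    proof (rule ccontr)
      assume none: "\<not> ?thesis"
      have pos: "0 < f x" if x: "\<gamma> \<le> x" "x \<le> 0.6491" for x
      proof (rule ccontr)
        assume "\<not> 0 < f x"
        then obtain y where "\<gamma> \<le> y" "y \<le> x" "f y = 0"
          using IVT2'[of f x 0 \<gamma>] cont False x by auto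
        then have "y \<in> {0..0.6491}" using x \<gamma>l by simp
        then show False using none \<open>f y = 0\<close> by blast
      qed
      \<comment> \<open>A positive \<open>f\<close> would keep falling faster than \<delta> over a
        length of at least \<epsilon>, losing all of its initial height, at most
        \<open>e\<close>.\<close>
      have "f 0.6491 \<le> f \<gamma> - \<delta> * (0.6491 - \<gamma>)"
        by (rule steep_decrease[OF _ der]) (use \<gamma>l right pos below_e in \<open>auto simp: less_imp_le\<close>)
      also have "\<dots> \<le> e - \<delta> * \<epsilon>"
        using f\<gamma>e \<epsilon> \<delta> by (intro diff_mono mult_left_mono) auto
      finally show False using pos[of "0.6491"] \<gamma>l by (simp add: e_def)
    qed
  qed
  have dist: "\<delta> * \<bar>\<gamma> - r\<bar> \<le> \<bar>f \<gamma>\<bar>" if r: "r \<in> {0..0.6491}" "f r = 0" for r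
  proof (cases "r \<le> \<gamma>")
    case True
    \<comment> \<open>Past its root \<open>f\<close> stays nonpositive, hence below \<delta>, so
      \<open>left\<close> applies on all of \<open>[r, \<gamma>]\<close>.\<close>
    have "f x \<le> 0" if "x \<in> {r..\<gamma>}" for x
      by (rule le_barrier_if_deriv_neg[of r \<gamma> f f']) (use der at_root that r \<gamma>l in auto)
    then have "f x < \<delta>" if "x \<in> {r..\<gamma>}" for x using that \<delta> by (meson le_less_trans)
    then have "f \<gamma> \<le> f r - \<delta> * (\<gamma> - r)"
      using left r True by (intro steep_decrease[OF _ der]) auto
    then show ?thesis using r True by simp
  next
    case False
    \<comment> \<open>A negative value before \<open>r\<close> would, since \<open>f 0 = 1\<close>,
      force an earlier root, against uniqueness.\<close>
    have "0 \<le> f x" if x: "x \<in> {\<gamma>..r}" for x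
    proof (rule ccontr)
      assume "\<not> 0 \<le> f x"
      then obtain y where y: "0 \<le> y" "y \<le> x" "f y = 0"
        using IVT2'[of f x 0 0] f0 cont x \<gamma>l by auto
      then have "y = r" using unique[of y r] r x y by simp
      then show False using \<open>\<not> 0 \<le> f x\<close> x y r by auto
    qed
    then have "f r \<le> f \<gamma> - \<delta> * (r - \<gamma>)"
      using right below_e r False by (intro steep_decrease[OF _ der]) auto
    then show ?thesis using r False by simp
  qed
  have "\<bar>\<gamma> - r\<bar> \<le> C1 * \<gamma> ^ n" if r: "r \<in> {0..0.6491}" "f r = 0" for r
  proof -
    have "\<delta> * \<bar>\<gamma> - r\<bar> \<le> \<gamma> ^ (n + 1) / (1 - \<gamma>)" using dist[OF r] f\<gamma> by linarith
    also have "\<dots> = \<delta> * (C1 * \<gamma> ^ n)" using \<delta> by (simp add: assms(12))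
    finally show ?thesis using \<delta> by simp
  qed
  then show "(\<exists>!x. x \<in> {0..0.6491} \<and> bit_poly b n x = 0) \<and>
      (\<forall>\<gamma>n. \<gamma>n \<in> {0..0.6491} \<and> bit_poly b n \<gamma>n = 0 \<longrightarrow> \<bar>\<gamma> - \<gamma>n\<bar> \<le> C1 * \<gamma> ^ n)"
    unfolding root_iff using ex unique by (intro conjI ex_ex1I allI impI) blast+
qed

end
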